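(* Let $\mathcal{B}=B(F)\subseteq 2^{[n]}$ be a principal Borel set with Borel generator $F=\{i_1<i_2<\cdots<i_d\}$, and let $\Delta$ be the simplicial complex with $\mathcal{F}(\Delta)=\mathcal{B}$. Then $x_1x_2\cdots x_{i_d}t^d$ belongs to the minimal set of monomial generators of the $S$-algebra $A(\Delta)$ if and only if $i_1\ne 1$.
   Context: Let $K$ be a field, $[n]=\{1,\ldots,n\}$ and $S=K[x_1,\ldots,x_n]$. A subset $\mathcal{B}\subseteq 2^{[n]}$ is Borel if whenever $F\in\mathcal{B}$, $i<j$, $i\in[n]\setminus F$ and $j\in F$, then $(F\setminus\{j\})\cup\{i\}\in\mathcal{B}$. $B(F)$ denotes the smallest Borel subset of $2^{[n]}$ containing $F$; such Borel sets are called principal, with Borel generator $F$. $\mathcal{F}(\Delta)$ is the set of facets (maximal faces) of a simplicial complex $\Delta$ on $[n]$. For an integer $k\ge 0$, a $k$-cover of $\Delta$ is a nonzero vector $c\in\mathbb{Z}_{\ge 0}^n$ with $\sum_{i\in G}c_i\ge k$ for every facet $G$. A $k$-cover $c$ is decomposable if $c=a+b$ with $a$ an $i$-cover, $b$ a $j$-cover and $k=i+j$ (where $i,j\ge 0$); otherwise it is indecomposable. Write $x^c=x_1^{c_1}\cdots x_n^{c_n}$. For $k\ge 1$, $J_k(\Delta)\subseteq S$ is the ideal spanned over $K$ by the monomials $x^c$ with $c$ a $k$-cover, $J_0(\Delta)=S$, and $A(\Delta)=\bigoplus_{k\ge 0}J_k(\Delta)t^k\subseteq S[t]$. The minimal set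 of monomial generators of the $S$-algebra $A(\Delta)$ consists of the $x^ct^k$ with $k\ge 1$ and $c$ an indecomposable $k$-cover.
   Formalization: The case F = {1} is excluded: there B(F) = {{1}} and x_1 t is a minimal generator (e_1 is an indecomposable 1-cover) although i_1 = 1, so the claim fails exactly for this F. *)

theory Defs
  imports "HOL-Library.Poly_Mapping" "HOL-Computational_Algebra.Polynomial"
begin

section \<open>Borel sets and simplicial complexes on \<open>{1..n}\<close>\<close>

definition borel_family :: "nat \<Rightarrow> nat set set \<Rightarrow> bool" where
  "borel_family n \<B> \<longleftrightarrow> \<B> \<subseteq> Pow {1..n} \<and>
     (\<forall>F\<in>\<B>. \<forall>i j. i < j \<longrightarrow> i \<in> {1..n} - F \<longrightarrow> j \<in> F \<longrightarrow> insert i (F - {j}) \<in> \<B>)"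

definition principal_borel :: "nat \<Rightarrow> nat set \<Rightarrow> nat set set" where
  "principal_borel n F = \<Inter>{\<B>. borel_family n \<B> \<and> F \<in> \<B>}"

text \<open>Elements of \<open>{1..n}\<close> need not be vertices of the complex: no element beyond
  \<open>Max F\<close> lies in a member of \<open>principal_borel n F\<close>.\<close>

definition simplicial_complex :: "nat \<Rightarrow> nat set set \<Rightarrow> bool" where
  "simplicial_complex n \<Delta> \<longleftrightarrow> \<Delta> \<noteq> {} \<and> \<Delta> \<subseteq> Pow {1..n} \<and> (\<forall>F\<in>\<Delta>. \<forall>G. G \<subseteq> F \<longrightarrow> G \<in> \<Delta>)"

definition facets :: "nat set set \<Rightarrow> nat set set" where
  "facets \<Delta> = {F \<in> \<Delta>. \<forall>G\<in>\<Delta>. F \<subseteq> G \<longrightarrow> G = F}"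


section \<open>The polynomial ring \<open>S = K[x\<^sub>1, \<dots>, x\<^sub>n]\<close>\<close>

text \<open>Exponent vectors in \<open>\<int>\<^bsub>\<ge>0\<^esub>\<^sup>n\<close> are the finitely supported functions
  \<open>nat \<Rightarrow>\<^sub>0 nat\<close> whose support is contained in \<open>{1..n}\<close>; the type \<open>'k mpoly\<close> is the polynomial
  ring over \<open>'k\<close> in variables indexed by all natural numbers, and \<open>S\<close> is a subring of it.\<close>

type_synonym 'k mpoly = "(nat \<Rightarrow>\<^sub>0 nat) \<Rightarrow>\<^sub>0 'k"

definition expos :: "nat \<Rightarrow> (nat \<Rightarrow>\<^sub>0 nat) set" where
  "expos n = {c. Poly_Mapping.keys c \<subseteq> {1..n}}"

definition poly_ring :: "nat \<Rightarrow> 'k::field mpoly set" where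
  "poly_ring n = {p. Poly_Mapping.keys p \<subseteq> expos n}"

definition xpow :: "(nat \<Rightarrow>\<^sub>0 nat) \<Rightarrow> 'k::field mpoly" where
  "xpow c = Poly_Mapping.single c 1"

definition var :: "nat \<Rightarrow> 'k::field mpoly" where
  "var i = xpow (Poly_Mapping.single i 1)"

definition scale_mpoly :: "'k::field \<Rightarrow> 'k mpoly \<Rightarrow> 'k mpoly" where
  "scale_mpoly a p = Poly_Mapping.single 0 a * p"

interpretation mpoly: vector_space scale_mpoly
  by unfold_locales
    (simp_all add: scale_mpoly_def distrib_left distrib_right single_add mult_single
      mult.assoc [symmetric])


section \<open>Vertex covers and the algebra \<open>A(\<Delta>)\<close>\<close>

definition kcover :: "nat \<Rightarrow> nat set set \<Rightarrow> nat \<Rightarrow> (nat \<Rightarrow>\<^sub>0 nat) \<Rightarrow> bool" where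
  "kcover n \<Delta> k c \<longleftrightarrow> c \<in> expos n \<and> c \<noteq> 0 \<and>
     (\<forall>G\<in>facets \<Delta>. k \<le> (\<Sum>i\<in>G. Poly_Mapping.lookup c i))"

definition cover_ideal :: "nat \<Rightarrow> nat set set \<Rightarrow> nat \<Rightarrow> 'k::field mpoly set" where
  "cover_ideal n \<Delta> k =
     (if k = 0 then poly_ring n else mpoly.span {xpow c | c. kcover n \<Delta> k c})"

text \<open>\<open>S[t]\<close> consists of the univariate polynomials with coefficients in \<open>S\<close>.\<close>

definition cover_algebra :: "nat \<Rightarrow> nat set set \<Rightarrow> 'k::field mpoly poly set" where
  "cover_algebra n \<Delta> = {f. \<forall>k. coeff f k \<in> cover_ideal n \<Delta> k}"

inductive_set S_algebra :: "nat \<Rightarrow> 'k::field mpoly poly set \<Rightarrow> 'k mpoly poly set"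
  for n :: nat and M :: "'k mpoly poly set" where
  const: "s \<in> poly_ring n \<Longrightarrow> [:s:] \<in> S_algebra n M"
| gen: "f \<in> M \<Longrightarrow> f \<in> S_algebra n M"
| add: "f \<in> S_algebra n M \<Longrightarrow> g \<in> S_algebra n M \<Longrightarrow> f + g \<in> S_algebra n M"
| mult: "f \<in> S_algebra n M \<Longrightarrow> g \<in> S_algebra n M \<Longrightarrow> f * g \<in> S_algebra n M"

definition monomial_generating_set ::
    "nat \<Rightarrow> 'k::field mpoly poly set \<Rightarrow> 'k mpoly poly set \<Rightarrow> bool" where
  "monomial_generating_set n A M \<longleftrightarrow>
     M \<subseteq> {monom (xpow c) k | c k. c \<in> expos n} \<and> S_algebra n M = A"

text \<open>For \<open>A = A(\<Delta>)\<close> an inclusion-minimal generating set of monomials exists and is unique: it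
  is the set of all \<open>x\<^sup>c t\<^sup>k\<close> with \<open>k \<ge> 1\<close> and \<open>c\<close> an indecomposable \<open>k\<close>-cover.  Here \<open>k \<ge> 1\<close>
  need not be imposed, as an element of \<open>S\<close> is redundant among \<open>S\<close>-algebra generators.

  If \<open>F = {1}\<close>, then \<open>principal_borel n F = {{1}}\<close>, \<open>A(\<Delta>) = S[x\<^sub>1 t]\<close> and \<open>x\<^sub>1 t\<close> is the only
  element of this set (the vector \<open>(1, 0, \<dots>, 0)\<close> is not a sum of two nonzero vectors), even
  though \<open>Min F = 1\<close>.\<close>

definition minimal_monomial_generators ::
    "nat \<Rightarrow> 'k::field mpoly poly set \<Rightarrow> 'k mpoly poly set" where
  "minimal_monomial_generators n A =
     (THE M. monomial_generating_set n A M \<and>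
        (\<forall>M'. M' \<subset> M \<longrightarrow> \<not> monomial_generating_set n A M'))"

end

theory Submission
  imports Defs
begin

text \<open>The exponents \<open>(c, k)\<close> of the monomials \<open>x\<^sup>c t\<^sup>k\<close> in \<open>A(\<Delta>)\<close> form a monoid graded by \<open>k\<close>,
  whose nonzero elements are the pairs of a \<open>k\<close>-cover \<open>c\<close> and its \<open>k\<close>.  Its elements are sums
  of irreducible ones, because the total degree of \<open>c\<close> is additive and is positive on
  nonzero elements; and since the algebra has these monomials as a \<open>K\<close>-basis, one with
  irreducible exponent cannot be produced from other monomials.  As the irreducible monomials
  with \<open>k = 0\<close> are scalars for an \<open>S\<close>-algebra, the indecomposable covers with \<open>k \<ge> 1\<close> give a
  monomial generating set contained in every other one
  (\<open>indecomposable_monomials_generate\<close>, \<open>indecomposable_in_generating_set\<close>), which settles what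
  the minimal generators are.

  There remains a question on the Borel set.  All its members have \<open>d = card F\<close> elements and lie
  in \<open>{1..Max F}\<close>, so the indicator vector \<open>c\<close> of \<open>{1..Max F}\<close> is a \<open>d\<close>-cover, and it has
  weight exactly \<open>d\<close> on every facet.  If \<open>c = a + b\<close> with an \<open>i\<close>-cover \<open>a\<close>, a \<open>j\<close>-cover \<open>b\<close> and
  \<open>i + j = d\<close>, this tightness forces \<open>a\<close> to have weight exactly \<open>i\<close> on every facet.  A Borel
  move that replaces \<open>q \<in> F\<close> by \<open>p < q\<close>, \<open>p \<notin> F\<close>, then shows \<open>a\<^sub>p = a\<^sub>q\<close>
  (\<open>tight_cover_summand_eq_on_move\<close>).  If \<open>1 \<notin> F\<close>, such moves
  link \<open>1\<close> to all of \<open>F\<close> and every \<open>p \<notin> F\<close> below \<open>Max F\<close> to \<open>Max F\<close>, so \<open>a\<close> is constant on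
  \<open>{1..Max F}\<close> and \<open>a\<close> or \<open>b\<close> vanishes, a contradiction.  If \<open>1 \<in> F\<close>, no move
  removes \<open>1\<close>, so the first unit vector is a \<open>1\<close>-cover and the indicator vector of \<open>{2..Max F}\<close>
  is a \<open>(d - 1)\<close>-cover; the latter is nonzero because \<open>F \<noteq> {1}\<close>.\<close>


section \<open>Monomials of the cover algebra\<close>

abbreviation lookup :: "('a \<Rightarrow>\<^sub>0 'b::zero) \<Rightarrow> 'a \<Rightarrow> 'b" where
  "lookup \<equiv> Poly_Mapping.lookup"

abbreviation keys :: "('a \<Rightarrow>\<^sub>0 'b::zero) \<Rightarrow> 'a set" where
  "keys \<equiv> Poly_Mapping.keys"

text \<open>The zero vector is adjoined in degree \<open>0\<close> to make this a graded monoid: it is not a cover,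
  but \<open>x\<^sup>0 t\<^sup>0 = 1\<close> lies in the algebra.\<close>

definition cover_exponents :: "nat \<Rightarrow> nat set set \<Rightarrow> nat \<Rightarrow> (nat \<Rightarrow>\<^sub>0 nat) set" where
  "cover_exponents n \<Delta> k = {c. kcover n \<Delta> k c \<or> k = 0 \<and> c = 0}"

lemma expos_add: "a \<in> expos n \<Longrightarrow> b \<in> expos n \<Longrightarrow> a + b \<in> expos n"
  using keys_add[of a b] by (auto simp: expos_def)

lemma kcover_add:
  assumes "kcover n \<Delta> i a" "kcover n \<Delta> j b"
  shows "kcover n \<Delta> (i + j) (a + b)"
proof -
  have "a + b \<noteq> 0"
  proof
    assume "a + b = 0"
    then have "lookup a x + lookup b x = 0" for x
      by (metis lookup_add lookup_zero)
    then have "a = 0" by (intro poly_mapping_eqI) simp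
    then show False using assms(1) by (simp add: kcover_def)
  qed
  then show ?thesis
    using assms by (auto simp: kcover_def expos_add lookup_add sum.distrib intro: add_mono)
qed

lemma cover_exponents_add:
  "a \<in> cover_exponents n \<Delta> i \<Longrightarrow> b \<in> cover_exponents n \<Delta> j
     \<Longrightarrow> a + b \<in> cover_exponents n \<Delta> (i + j)"
  by (auto simp: cover_exponents_def intro: kcover_add)

lemma keys_xpow [simp]: "keys (xpow c :: 'k::field mpoly) = {c}"
  by (simp add: xpow_def)

lemma poly_mapping_sum_singles:
  "(\<Sum>c\<in>keys p. Poly_Mapping.single c (lookup p c)) = p"
  by (rule poly_mapping_eqI)
    (simp add: lookup_sum lookup_single when_def in_keys_iff)

lemma span_xpow:
  "mpoly.span {xpow c | c. P c} = {p :: 'k::field mpoly. keys p \<subseteq> Collect P}"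
proof (intro equalityI subsetI)
  fix p :: "'k mpoly"
  assume p: "p \<in> mpoly.span {xpow c | c. P c}"
  have "mpoly.subspace {p :: 'k mpoly. keys p \<subseteq> Collect P}"
  proof (rule mpoly.subspaceI)
    fix x y :: "'k mpoly" and a :: 'k
    show "0 \<in> {p :: 'k mpoly. keys p \<subseteq> Collect P}" by simp
    assume x: "x \<in> {p. keys p \<subseteq> Collect P}"
    then show "scale_mpoly a x \<in> {p. keys p \<subseteq> Collect P}"
      using keys_mult[of "Poly_Mapping.single 0 a" x]
      by (auto simp: scale_mpoly_def split: if_splits)
    assume "y \<in> {p. keys p \<subseteq> Collect P}"
    then show "x + y \<in> {p. keys p \<subseteq> Collect P}"
      using x keys_add[of x y] by auto
  qed
  then have "mpoly.span {xpow c | c. P c} \<subseteq> {p :: 'k mpoly. keys p \<subseteq> Collect P}"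
    by (rule mpoly.span_minimal[rotated]) auto
  with p show "p \<in> {p. keys p \<subseteq> Collect P}"
    by blast
next
  fix p :: "'k mpoly"
  assume p: "p \<in> {p. keys p \<subseteq> Collect P}"
  have "p = (\<Sum>c\<in>keys p. scale_mpoly (lookup p c) (xpow c))"
    by (simp add: scale_mpoly_def xpow_def mult_single poly_mapping_sum_singles)
  also have "\<dots> \<in> mpoly.span {xpow c | c. P c}"
    using p by (intro mpoly.span_sum mpoly.span_scale mpoly.span_base) auto
  finally show "p \<in> mpoly.span {xpow c | c. P c}" .
qed

lemma cover_ideal_eq: "cover_ideal n \<Delta> k = {p. keys p \<subseteq> cover_exponents n \<Delta> k}"
proof (cases "k = 0")
  case True
  have "cover_exponents n \<Delta> 0 = expos n"
    by (auto simp: cover_exponents_def kcover_def expos_def)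
  then show ?thesis using True by (simp add: cover_ideal_def poly_ring_def)
next
  case False
  then show ?thesis by (simp add: cover_ideal_def cover_exponents_def span_xpow)
qed

lemma in_cover_algebra_iff:
  "f \<in> cover_algebra n \<Delta> \<longleftrightarrow> (\<forall>k. keys (coeff f k) \<subseteq> cover_exponents n \<Delta> k)"
  by (simp add: cover_algebra_def cover_ideal_eq)

lemma keys_coeff_mult:
  fixes f g :: "'k::field mpoly poly"
  assumes "c \<in> keys (coeff (f * g) k)"
  obtains a b i j where "a \<in> keys (coeff f i)" "b \<in> keys (coeff g j)" "c = a + b" "k = i + j"
proof -
  have "(\<Sum>i\<le>k. lookup (coeff f i * coeff g (k - i)) c) \<noteq> 0"
    using assms by (simp add: coeff_mult lookup_sum in_keys_iff)
  then obtain i where i: "i \<le> k" "c \<in> keys (coeff f i * coeff g (k - i))"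
    by (metis (no_types, lifting) atMost_iff in_keys_iff sum.neutral)
  then obtain a b where "a \<in> keys (coeff f i)" "b \<in> keys (coeff g (k - i))" "c = a + b"
    using keys_mult by fast
  with i(1) show ?thesis by (intro that) auto
qed

lemma monom_xpow_in_cover_algebra:
  "c \<in> cover_exponents n \<Delta> k \<Longrightarrow> monom (xpow c) k \<in> cover_algebra n \<Delta>"
  by (auto simp: in_cover_algebra_iff)

lemma S_algebra_subset_cover_algebra:
  assumes "M \<subseteq> cover_algebra n \<Delta>"
  shows "S_algebra n M \<subseteq> cover_algebra n \<Delta>"
proof
  fix f assume "f \<in> S_algebra n M"
  then show "f \<in> cover_algebra n \<Delta>"
  proof induction
    case (const s)
    then show ?case
      by (auto simp: cover_algebra_def cover_ideal_eq coeff_pCons poly_ring_def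
            cover_exponents_def kcover_def split: nat.splits)
  next
    case (gen f)
    then show ?case using assms by auto
  next
    case (add f g)
    then show ?case
      unfolding in_cover_algebra_iff coeff_add by (meson Un_least keys_add order_trans)
  next
    case (mult f g)
    show ?case
      unfolding in_cover_algebra_iff
    proof (intro allI subsetI)
      fix k c assume "c \<in> keys (coeff (f * g) k)"
      then obtain a b i j where
        "a \<in> keys (coeff f i)" "b \<in> keys (coeff g j)" "c = a + b" "k = i + j"
        by (rule keys_coeff_mult)
      then show "c \<in> cover_exponents n \<Delta> k"
        using mult.IH unfolding in_cover_algebra_iff
        by (metis cover_exponents_add subsetD)
    qed
  qed
qed


section \<open>The minimal monomial generators are the indecomposable covers\<close>

definition indecomposable_cover :: "nat \<Rightarrow> nat set set \<Rightarrow> nat \<Rightarrow> (nat \<Rightarrow>\<^sub>0 nat) \<Rightarrow> bool" where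
  "indecomposable_cover n \<Delta> k c \<longleftrightarrow> kcover n \<Delta> k c \<and>
     (\<forall>i j a b. kcover n \<Delta> i a \<longrightarrow> kcover n \<Delta> j b \<longrightarrow> c = a + b \<longrightarrow> k \<noteq> i + j)"

definition indecomposable_monomials :: "nat \<Rightarrow> nat set set \<Rightarrow> 'k::field mpoly poly set" where
  "indecomposable_monomials n \<Delta> = {monom (xpow c) k | c k. k \<ge> 1 \<and> indecomposable_cover n \<Delta> k c}"

lemma monom_xpow_in_indecomposable_monomials_iff:
  "monom (xpow c) k \<in> (indecomposable_monomials n \<Delta> :: 'k::field mpoly poly set)
     \<longleftrightarrow> k \<ge> 1 \<and> indecomposable_cover n \<Delta> k c"
proof -
  have "c = c' \<and> k = k'" if "monom (xpow c :: 'k mpoly) k = monom (xpow c') k'" for c' k'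
  proof -
    have "c \<in> keys (coeff (monom (xpow c' :: 'k mpoly) k') k)"
      by (simp flip: that)
    then show ?thesis by (simp split: if_splits)
  qed
  then show ?thesis by (auto simp: indecomposable_monomials_def)
qed

text \<open>Decomposing as long as possible terminates: both parts of a decomposition are nonzero, so
  each has smaller total degree.\<close>

lemma kcover_monomial_generated:
  "kcover n \<Delta> k c
     \<Longrightarrow> monom (xpow c :: 'k::field mpoly) k \<in> S_algebra n (indecomposable_monomials n \<Delta>)"
proof (induction "\<Sum>i\<in>{1..n}. lookup c i" arbitrary: c k rule: less_induct)
  case less
  have pos: "(\<Sum>i\<in>{1..n}. lookup a i) > 0" if "kcover n \<Delta> j a" for j a
  proof -
    have "keys a \<noteq> {}" "keys a \<subseteq> {1..n}"
      using that by (auto simp: kcover_def expos_def)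
    then obtain i where "i \<in> {1..n}" "i \<in> keys a" by blast
    then show ?thesis by (intro sum_pos2[where i = i]) (auto simp: in_keys_iff)
  qed
  consider "k = 0" | "k \<noteq> 0" "indecomposable_cover n \<Delta> k c"
    | i j a b where "kcover n \<Delta> i a" "kcover n \<Delta> j b" "c = a + b" "k = i + j"
    using less.prems unfolding indecomposable_cover_def by blast
  then show ?case
  proof cases
    case 1
    then show ?thesis
      using less.prems S_algebra.const[of "xpow c" n]
      by (simp add: poly_ring_def xpow_def kcover_def monom_0)
  next
    case 2
    then show ?thesis
      by (intro S_algebra.gen) (simp add: monom_xpow_in_indecomposable_monomials_iff)
  next
    case 3
    have "(\<Sum>i\<in>{1..n}. lookup c i) = (\<Sum>i\<in>{1..n}. lookup a i) + (\<Sum>i\<in>{1..n}. lookup b i)"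
      by (simp add: 3 lookup_add sum.distrib)
    then have "monom (xpow a :: 'k mpoly) i * monom (xpow b) j
        \<in> S_algebra n (indecomposable_monomials n \<Delta>)"
      using 3 pos[of i a] pos[of j b] by (intro S_algebra.mult less.hyps) auto
    then show ?thesis by (simp add: 3 mult_monom xpow_def mult_single)
  qed
qed

lemma S_algebra_sum:
  assumes "finite I" "\<And>i. i \<in> I \<Longrightarrow> f i \<in> S_algebra n M"
  shows "sum f I \<in> S_algebra n M"
  using assms
proof (induction I rule: finite_induct)
  case empty
  then show ?case using S_algebra.const[of 0 n M] by (simp add: poly_ring_def)
next
  case (insert i I)
  then show ?case by (simp add: S_algebra.add)
qed

lemma indecomposable_monomials_generate:
  "S_algebra n (indecomposable_monomials n \<Delta>) = (cover_algebra n \<Delta> :: 'k::field mpoly poly set)"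
    (is "?S = ?A")
proof
  show "?S \<subseteq> ?A"
    by (intro S_algebra_subset_cover_algebra)
      (auto simp: indecomposable_monomials_def indecomposable_cover_def cover_exponents_def
        intro!: monom_xpow_in_cover_algebra)
  have scalar: "[:Poly_Mapping.single 0 r:] \<in> ?S" for r :: 'k
    by (intro S_algebra.const) (simp add: poly_ring_def expos_def)
  have monomial: "monom (Poly_Mapping.single c r) k \<in> ?S"
    if "c \<in> cover_exponents n \<Delta> k" for c k and r :: 'k
  proof -
    have "monom (xpow c) k \<in> ?S"
      using that scalar[of 1] kcover_monomial_generated[of n \<Delta> k c]
      by (auto simp: cover_exponents_def monom_0 xpow_def)
    then have "[:Poly_Mapping.single 0 r:] * monom (xpow c) k \<in> ?S"
      using scalar by (rule S_algebra.mult[rotated])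
    then show ?thesis by (simp add: xpow_def smult_monom mult_single)
  qed
  show "?A \<subseteq> ?S"
  proof
    fix f :: "'k mpoly poly" assume f: "f \<in> ?A"
    have "monom (coeff f k) k \<in> ?S" for k
    proof -
      have "monom (coeff f k) k
          = (\<Sum>c\<in>keys (coeff f k). monom (Poly_Mapping.single c (lookup (coeff f k) c)) k)"
        by (simp add: poly_mapping_sum_singles flip: monom_sum)
      then show ?thesis
        using f by (auto simp: in_cover_algebra_iff intro!: S_algebra_sum monomial)
    qed
    then have "(\<Sum>k\<le>degree f. monom (coeff f k) k) \<in> ?S"
      by (intro S_algebra_sum) auto
    then show "f \<in> ?S" by (simp add: poly_as_sum_of_monoms)
  qed
qed

text \<open>Sums and products of elements of the algebra in which the coefficient of \<open>x\<^sup>c t\<^sup>k\<close> is zero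
  have the same property: the coefficient in a product only collects contributions from
  factorizations of \<open>x\<^sup>c t\<^sup>k\<close> into monomials of the algebra, and each of them has a factor \<open>1\<close>.\<close>

lemma indecomposable_in_generating_set:
  fixes M :: "'k::field mpoly poly set"
  assumes M: "monomial_generating_set n (cover_algebra n \<Delta>) M"
    and k: "k \<ge> 1" and c: "indecomposable_cover n \<Delta> k c"
  shows "monom (xpow c) k \<in> M"
proof (rule ccontr)
  assume notin: "monom (xpow c) k \<notin> M"
  have gen: "S_algebra n M = cover_algebra n \<Delta>"
    and mon: "M \<subseteq> {monom (xpow c) k | c k. c \<in> expos n}"
    using M by (auto simp: monomial_generating_set_def)
  have "c \<notin> keys (coeff f k)" if "f \<in> S_algebra n M" for f
    using that
  proof induction
    case (const s)
    then show ?case using k by (cases k) auto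
  next
    case (gen f)
    then show ?case using notin mon by (auto split: if_splits)
  next
    case (add f g)
    then show ?case using keys_add[of "coeff f k" "coeff g k"] by auto
  next
    case (mult f g)
    show ?case
    proof
      assume "c \<in> keys (coeff (f * g) k)"
      then obtain a b i j where ab: "a \<in> keys (coeff f i)" "b \<in> keys (coeff g j)"
        "c = a + b" "k = i + j"
        by (rule keys_coeff_mult)
      have "a \<in> cover_exponents n \<Delta> i" "b \<in> cover_exponents n \<Delta> j"
        using mult.hyps ab(1,2) unfolding gen in_cover_algebra_iff by blast+
      then consider "a = 0" "i = 0" | "b = 0" "j = 0" | "kcover n \<Delta> i a" "kcover n \<Delta> j b"
        unfolding cover_exponents_def by blast
      then show False
      proof cases
        case 3
        then show False using c ab(3,4) unfolding indecomposable_cover_def by blast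
      qed (use ab mult.IH in simp_all)
    qed
  qed
  moreover have "monom (xpow c) k \<in> S_algebra n M"
    using c unfolding gen
    by (intro monom_xpow_in_cover_algebra)
      (simp add: indecomposable_cover_def cover_exponents_def)
  ultimately show False by fastforce
qed

theorem minimal_monomial_generators_cover_algebra:
  "minimal_monomial_generators n (cover_algebra n \<Delta>)
     = (indecomposable_monomials n \<Delta> :: 'k::field mpoly poly set)" (is "_ = ?G")
proof -
  have G: "monomial_generating_set n (cover_algebra n \<Delta>) ?G"
    unfolding monomial_generating_set_def indecomposable_monomials_generate
    by (auto simp: indecomposable_monomials_def indecomposable_cover_def kcover_def)
  have least: "?G \<subseteq> M" if "monomial_generating_set n (cover_algebra n \<Delta>) M" for M
    using that indecomposable_in_generating_set by (auto simp: indecomposable_monomials_def)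
  show ?thesis
    unfolding minimal_monomial_generators_def using G least by (intro the_equality) blast+
qed


section \<open>Principal Borel sets\<close>

lemma borel_family_principal_borel:
  assumes "F \<subseteq> {1..n}"
  shows "borel_family n (principal_borel n F)"
proof -
  have "borel_family n (Pow {1..n})" by (auto simp: borel_family_def)
  then have "principal_borel n F \<subseteq> Pow {1..n}" using assms by (auto simp: principal_borel_def)
  then show ?thesis unfolding borel_family_def principal_borel_def by blast
qed

lemma generator_in_principal_borel: "F \<in> principal_borel n F"
  by (simp add: principal_borel_def)

text \<open>Borel moves only replace elements by smaller ones and therefore preserve these three
  properties.  In particular \<open>1\<close> is never removed.\<close>

lemma principal_borel_member:
  assumes F: "F \<subseteq> {1..n}" and G: "G \<in> principal_borel n F"
  shows "G \<subseteq> {1..Max F}" "card G = card F" "1 \<in> F \<Longrightarrow> 1 \<in> G"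
proof -
  let ?C = "{G. G \<subseteq> {1..n} \<and> G \<subseteq> {1..Max F} \<and> card G = card F \<and> (1 \<in> F \<longrightarrow> 1 \<in> G)}"
  have "finite F" using F finite_subset by blast
  then have "F \<in> ?C" using F by auto
  moreover have "borel_family n ?C"
    unfolding borel_family_def
  proof (intro conjI ballI allI impI)
    fix G i j
    assume G: "G \<in> ?C" and ij: "i < j" "i \<in> {1..n} - G" "j \<in> G"
    have "finite G" using G finite_subset by blast
    then have "card (insert i (G - {j})) = card G"
      using ij(2) card.remove[OF _ ij(3)] by simp
    moreover have "j \<le> Max F" using G ij by auto
    ultimately show "insert i (G - {j}) \<in> ?C" using G ij by auto
  qed auto
  ultimately have "G \<in> ?C" using G by (auto simp: principal_borel_def)
  then show "G \<subseteq> {1..Max F}" "card G = card F" "1 \<in> F \<Longrightarrow> 1 \<in> G" by auto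
qed


section \<open>Squarefree covers of principal Borel complexes\<close>

definition indicator_expo :: "nat set \<Rightarrow> (nat \<Rightarrow>\<^sub>0 nat)" where
  "indicator_expo I = (\<Sum>i\<in>I. Poly_Mapping.single i 1)"

lemma lookup_indicator_expo:
  "finite I \<Longrightarrow> lookup (indicator_expo I) i = (if i \<in> I then 1 else 0)"
  by (simp add: indicator_expo_def lookup_sum lookup_single when_def)

lemma keys_indicator_expo: "finite I \<Longrightarrow> keys (indicator_expo I) = I"
  by (auto simp: in_keys_iff lookup_indicator_expo split: if_splits)

lemma prod_var: "finite I \<Longrightarrow> (\<Prod>i\<in>I. var i) = xpow (indicator_expo I)"
  by (induction I rule: finite_induct)
    (simp_all add: indicator_expo_def var_def xpow_def mult_single)

lemma sum_lookup_indicator_expo: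
  "finite I \<Longrightarrow> finite G \<Longrightarrow> (\<Sum>i\<in>G. lookup (indicator_expo I) i) = card (G \<inter> I)"
  by (simp add: lookup_indicator_expo flip: sum.inter_restrict)

lemma kcover_indicator_expo_iff:
  assumes I: "I \<subseteq> {1..n}" "I \<noteq> {}" and fin: "\<And>G. G \<in> facets \<Delta> \<Longrightarrow> finite G"
  shows "kcover n \<Delta> k (indicator_expo I) \<longleftrightarrow> (\<forall>G\<in>facets \<Delta>. k \<le> card (G \<inter> I))"
proof -
  have "finite I" using I(1) finite_subset by blast
  moreover from this have "indicator_expo I \<noteq> 0"
    using I(2) keys_indicator_expo[of I] by auto
  ultimately show ?thesis
    using I(1) fin by (simp add: kcover_def expos_def keys_indicator_expo sum_lookup_indicator_expo)
qed

text \<open>Tightness of \<open>a + b\<close> on both facets makes \<open>a\<close> tight there too, and a Borel move changes the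
  weight of \<open>a\<close> by the difference of the two entries.\<close>

lemma tight_cover_summand_eq_on_move:
  assumes a: "kcover n \<Delta> i a" and b: "kcover n \<Delta> j b"
    and tight: "\<And>G. G \<in> facets \<Delta> \<Longrightarrow> (\<Sum>x\<in>G. lookup (a + b) x) = i + j"
    and G: "G \<in> facets \<Delta>" "finite G" "q \<in> G" "p \<notin> G" "insert p (G - {q}) \<in> facets \<Delta>"
  shows "lookup a p = lookup a q"
proof -
  have weight: "(\<Sum>x\<in>H. lookup a x) = i" if "H \<in> facets \<Delta>" for H
  proof -
    have "i \<le> (\<Sum>x\<in>H. lookup a x)" "j \<le> (\<Sum>x\<in>H. lookup b x)"
      using a b that by (auto simp: kcover_def)
    moreover have "(\<Sum>x\<in>H. lookup a x) + (\<Sum>x\<in>H. lookup b x) = i + j"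
      using tight[OF that] by (simp add: lookup_add sum.distrib)
    ultimately show ?thesis by linarith
  qed
  have "lookup a p + (\<Sum>x\<in>G - {q}. lookup a x) = i"
    using weight[OF G(5)] G(2,4) by simp
  moreover have "lookup a q + (\<Sum>x\<in>G - {q}. lookup a x) = i"
    using weight[OF G(1)] G(2,3) by (simp add: sum.remove)
  ultimately show ?thesis by linarith
qed

lemma indecomposable_indicator_expo:
  assumes F: "F \<subseteq> {1..n}" "F \<noteq> {}" and facets: "facets \<Delta> = principal_borel n F"
    and 1: "1 \<notin> F"
  shows "indecomposable_cover n \<Delta> (card F) (indicator_expo {1..Max F})"
proof -
  let ?m = "Max F"
  have finF: "finite F" using F(1) finite_subset by blast
  then have m: "?m \<in> F" "?m \<le> n" "1 \<le> ?m" using F Max_in[of F] by (auto simp: subset_iff)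
  have fin: "finite G" if "G \<in> facets \<Delta>" for G
    using principal_borel_member(1)[OF F(1), of G] that facets finite_subset by auto
  have weight: "card (G \<inter> {1..?m}) = card F" if "G \<in> facets \<Delta>" for G
    using principal_borel_member(1,2)[OF F(1), of G] that facets by (simp add: Int_absorb2)
  have cover: "kcover n \<Delta> (card F) (indicator_expo {1..?m})"
    using m fin weight by (subst kcover_indicator_expo_iff) auto
  have False
    if a: "kcover n \<Delta> i a" and b: "kcover n \<Delta> j b" and ab: "indicator_expo {1..?m} = a + b"
      and ij: "card F = i + j" for i j a b
  proof -
    have tight: "(\<Sum>x\<in>G. lookup (a + b) x) = i + j" if "G \<in> facets \<Delta>" for G
      using that weight fin ij by (simp add: sum_lookup_indicator_expo flip: ab)
    have move: "lookup a p = lookup a q" if "q \<in> F" "p \<notin> F" "p < q" "1 \<le> p" for p q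
    proof -
      have "p \<in> {1..n} - F" using that F(1) by auto
      then have "insert p (F - {q}) \<in> facets \<Delta>"
        using borel_family_principal_borel[OF F(1)] generator_in_principal_borel[of F n] that
        unfolding borel_family_def facets by blast
      moreover have "F \<in> facets \<Delta>" by (simp add: facets generator_in_principal_borel)
      ultimately show ?thesis
        using tight finF that by (intro tight_cover_summand_eq_on_move[OF a b, of F q p])
    qed
    \<comment> \<open>Moves link \<open>1\<close> to each element of \<open>F\<close>, and each gap of \<open>F\<close> to \<open>Max F\<close>.\<close>
    have a_const: "lookup a p = lookup a 1" if "p \<in> {1..?m}" for p
    proof (cases "p \<in> F")
      case True
      with 1 that have "1 < p" by (cases "p = 1") auto
      with True 1 show ?thesis using move[of p 1] by simp
    next
      case False
      with that m(1) have "p < ?m" by (cases "p = ?m") auto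
      with False m(1) that have "lookup a p = lookup a ?m"
        by (intro move) auto
      moreover have "1 < ?m" using 1 m(1,3) by (cases "?m = 1") auto
      then have "lookup a 1 = lookup a ?m"
        using 1 m(1) by (intro move) auto
      ultimately show ?thesis by simp
    qed
    have sum: "lookup a p + lookup b p = (if p \<in> {1..?m} then 1 else 0)" for p
      by (metis ab lookup_add lookup_indicator_expo finite_atLeastAtMost)
    have "a = 0 \<or> b = 0"
    proof (cases "lookup a 1 = 0")
      case True
      have "lookup a p = 0" for p using sum[of p] a_const[of p] True by (auto split: if_splits)
      then show ?thesis by (auto intro!: poly_mapping_eqI)
    next
      case False
      have "lookup b p = 0" for p using sum[of p] a_const[of p] False by (auto split: if_splits)
      then show ?thesis by (auto intro!: poly_mapping_eqI)
    qed
    then show False using a b by (auto simp: kcover_def)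
  qed
  then show ?thesis using cover unfolding indecomposable_cover_def by blast
qed

text \<open>The vector splits off the first unit vector, a \<open>1\<close>-cover because every facet contains \<open>1\<close>.
  For \<open>F = {1}\<close> the other part would be the zero vector, which is not a cover.\<close>

lemma decomposable_indicator_expo:
  assumes F: "F \<subseteq> {1..n}" "F \<noteq> {1}" and facets: "facets \<Delta> = principal_borel n F"
    and 1: "1 \<in> F"
  shows "\<not> indecomposable_cover n \<Delta> (card F) (indicator_expo {1..Max F})"
proof -
  let ?m = "Max F"
  have finF: "finite F" using F(1) finite_subset by blast
  obtain x where x: "x \<in> F" "x \<noteq> 1" using F(2) 1 by auto
  then have "x \<ge> 2" using F(1) by force
  moreover have "x \<le> ?m" using x(1) finF by simp
  moreover have "?m \<in> F" using finF 1 by (intro Max_in) auto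
  ultimately have m: "2 \<le> ?m" "?m \<le> n" using F(1) by auto
  have fin: "finite G" if "G \<in> facets \<Delta>" for G
    using principal_borel_member(1)[OF F(1), of G] that facets finite_subset by auto
  have "kcover n \<Delta> 1 (indicator_expo {1})"
  proof -
    have "1 \<in> G" if "G \<in> facets \<Delta>" for G
      using principal_borel_member(3)[OF F(1), of G] that facets 1 by simp
    then show ?thesis using m fin by (subst kcover_indicator_expo_iff) auto
  qed
  moreover have "kcover n \<Delta> (card F - 1) (indicator_expo {2..?m})"
  proof -
    have "card (G \<inter> {2..?m}) = card F - 1" if "G \<in> facets \<Delta>" for G
    proof -
      have "G \<inter> {2..?m} = G - {1}"
        using principal_borel_member(1)[OF F(1), of G] that facets by force
      then show ?thesis
        using principal_borel_member(2,3)[OF F(1), of G] that facets 1 fin by simp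
    qed
    then show ?thesis using m fin by (subst kcover_indicator_expo_iff) auto
  qed
  moreover have "indicator_expo {1..?m} = indicator_expo {1} + indicator_expo {2..?m}"
    using m(1) by (intro poly_mapping_eqI) (auto simp: lookup_add lookup_indicator_expo)
  moreover have "card F = 1 + (card F - 1)"
    using card.remove[OF finF 1] by simp
  ultimately show ?thesis unfolding indecomposable_cover_def by blast
qed

theorem proposition3p8:
  fixes n :: nat and F :: "nat set" and \<B> \<Delta> :: "nat set set"
  assumes "F \<subseteq> {1..n}" and "F \<noteq> {}" and "F \<noteq> {1}"
    and "\<B> = principal_borel n F"
    and "simplicial_complex n \<Delta>" and "facets \<Delta> = \<B>"
  shows "monom (\<Prod>i\<in>{1..Max F}. var i) (card F)
           \<in> minimal_monomial_generators n (cover_algebra n \<Delta> :: 'k::field mpoly poly set)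
         \<longleftrightarrow> Min F \<noteq> 1"
proof -
  have finF: "finite F" using assms(1) finite_subset by blast
  then have "card F \<ge> 1" using assms(2) by (simp add: card_gt_0_iff Suc_le_eq)
  moreover have "Min F = 1 \<longleftrightarrow> 1 \<in> F"
  proof
    show "1 \<in> F" if "Min F = 1" using Min_in[OF finF assms(2)] that by simp
    show "Min F = 1" if "1 \<in> F" using finF assms(1) that by (intro Min_eqI) auto
  qed
  moreover have "indecomposable_cover n \<Delta> (card F) (indicator_expo {1..Max F}) \<longleftrightarrow> 1 \<notin> F"
    using indecomposable_indicator_expo decomposable_indicator_expo assms by metis
  ultimately show ?thesis
    by (simp add: minimal_monomial_generators_cover_algebra prod_var
        monom_xpow_in_indecomposable_monomials_iff)
qed

end
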